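(* For $i=1,\dots,s$ let $r_i(\lambda)$ be the rational functions in barycentric form $$r_i(\lambda)=\sum_{j=1}^{\ell_i}\frac{g_i(z_j^i)w_j^i}{\lambda-z_j^i}\Big/\sum_{j=1}^{\ell_i}\frac{w_j^i}{\lambda-z_j^i},$$ represented as the quotients of polynomials $r_i(\lambda)=p_i(\lambda)/q_i(\lambda)$ with $$p_i(\lambda)=\Big(\prod_{j=1}^{\ell_i}(\lambda-z_j^i)\Big)\sum_{j=1}^{\ell_i}\frac{g_i(z_j^i)w_j^i}{\lambda-z_j^i},\qquad q_i(\lambda)=\Big(\prod_{j=1}^{\ell_i}(\lambda-z_j^i)\Big)\sum_{j=1}^{\ell_i}\frac{w_j^i}{\lambda-z_j^i},$$ and assume that, for each $i=1,\dots,s$, this representation is irreducible (i.e. $p_i$ and $q_i$ have no common zero). Let $$\mathcal{L}_R(\lambda)=\left[\begin{array}{c|c}\begin{array}{ccc}A_0-\lambda B_0&\cdots&A_{k-1}-\lambda B_{k-1}\end{array} & \begin{array}{ccc}a_1^T\otimes(C_1-\lambda D_1)&\cdots&a_s^T\otimes(C_s-\lambda D_s)\end{array}\\ (X-\lambda Y)\otimes I_n & 0\\ \hline \begin{array}{cc}-b\otimes I_n & 0\end{array} & (E-\lambda F)\otimes I_n\end{array}\right],$$ where $b:=[b_1^T\ \cdots\ b_s^T]^T$ and $E-\lambda F:=\operatorname{diag}(E_1-\lambda F_1,\ldots,E_s-\lambda F_s)$, with all data as described in the context. If the pencils $C_i-\lambda D_i$ and $E_i-\lambda F_i$ are regular for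 $i=1,\ldots,s$ and the following conditions hold: (a) $C_i-\lambda D_i$ and $E_i-\lambda F_i$ have no finite eigenvalues in common for $i=1,\ldots,s$, and (b) $E_i-\lambda F_i$ and $E_j-\lambda F_j$ with $i\ne j$ have no finite eigenvalues in common for $i,j=1,\ldots,s$, then $\mathcal{L}_R(\lambda)$, viewed as a polynomial system matrix with state matrix $(E-\lambda F)\otimes I_n$, is minimal in $\mathbb{C}$.
   Context: Data. $A_i,B_i$ ($0\le i\le k-1$) and $C_i,D_i$ ($1\le i\le s$) are constant matrices in $\mathbb{C}^{n\times n}$. $X-\lambda Y$ is a $(k-1)\times k$ pencil with $\operatorname{rank}(X-\lambda Y)=k-1$ for all $\lambda\in\mathbb{C}$, and there are scalar polynomials $f_0(\lambda)\equiv 1,f_1(\lambda),\dots,f_{k-1}(\lambda)$ such that $(X-\lambda Y)[f_0(\lambda)\ \cdots\ f_{k-1}(\lambda)]^T=0$. For each $i=1,\dots,s$, $g_i$ is a scalar function, $z_1^i,\dots,z_{\ell_i}^i\in\mathbb{C}$ are distinct support points, $w_1^i,\dots,w_{\ell_i}^i\in\mathbb{C}$ are nonzero weights, $a_i=[g_i(z_1^i)w_1^i\ \cdots\ g_i(z_{\ell_i}^i)w_{\ell_i}^i]^T\in\mathbb{C}^{\ell_i}$, $b_i=[1\ 0\ \cdots\ 0]^T\in\mathbb{C}^{\ell_i}$, and $E_i-\lambda F_i$ is the $\ell_i\times\ell_i$ pencil $$E_i-\lambda F_i=\begin{bmatrix} w_1^i&w_2^i&\cdots&w_{\ell_i-1}^i&w_{\ell_i}^i\\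 \lambda-z_1^i&z_2^i-\lambda\\ &\lambda-z_2^i&\ddots\\ &&\ddots&z_{\ell_i-1}^i-\lambda\\ &&&\lambda-z_{\ell_i-1}^i&z_{\ell_i}^i-\lambda\end{bmatrix}.$$ A pencil is a polynomial matrix of degree at most $1$; a square pencil is regular if its determinant is not identically zero, and the finite eigenvalues of a regular pencil are the $\lambda_0\in\mathbb{C}$ at which its determinant vanishes. Minimality: partition $\mathcal{L}_R(\lambda)=\begin{bmatrix}\mathcal{D}(\lambda)&-\mathcal{C}(\lambda)\\ \mathcal{B}(\lambda)&\mathcal{A}(\lambda)\end{bmatrix}$ according to the lines, with state matrix $\mathcal{A}(\lambda)=(E-\lambda F)\otimes I_n$ of size $N=n\sum_i\ell_i$. It is minimal in $\mathbb{C}$ if $\operatorname{rank}\begin{bmatrix}\mathcal{A}(\lambda_0)\\ \mathcal{C}(\lambda_0)\end{bmatrix}=\operatorname{rank}\begin{bmatrix}\mathcal{A}(\lambda_0)&\mathcal{B}(\lambda_0)\end{bmatrix}=N$ for all $\lambda_0\in\mathbb{C}$. *)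

theory Defs
  imports
    "HOL-Computational_Algebra.Polynomial_Factorial"
    "Jordan_Normal_Form.Matrix"
    "Jordan_Normal_Form.Determinant"
    "Jordan_Normal_Form.DL_Rank"
begin

text \<open>
  Polynomial matrices in \<open>\<lambda>\<close> are matrices over \<^typ>\<open>complex poly\<close>. Indexed families keep
  the index ranges of the mathematical text: \<open>A i\<close> for \<open>i < k\<close>, \<open>C i\<close> for \<open>1 \<le> i \<le> s\<close>,
  \<open>z i j\<close> and \<open>w i j\<close> for \<open>1 \<le> j \<le> l i\<close>; values outside these ranges are irrelevant. Matrix
  entries themselves are 0-based, as everywhere in the library.
\<close>

definition kron :: "'a :: times mat \<Rightarrow> 'a mat \<Rightarrow> 'a mat" (infixl \<open>\<otimes>\<^sub>m\<close> 70) where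
  "A \<otimes>\<^sub>m B = mat (dim_row A * dim_row B) (dim_col A * dim_col B)
     (\<lambda>(i, j). A $$ (i div dim_row B, j div dim_col B) * B $$ (i mod dim_row B, j mod dim_col B))"

definition append_cols :: "'a :: zero mat \<Rightarrow> 'a mat \<Rightarrow> 'a mat" (infixr \<open>@\<^sub>c\<close> 65) where
  "A @\<^sub>c B = four_block_mat A B (0\<^sub>m 0 (dim_col A)) (0\<^sub>m 0 (dim_col B))"

text \<open>The argument \<open>nr\<close> is the common number of rows of the blocks.\<close>

definition row_block_mat :: "nat \<Rightarrow> 'a :: zero mat list \<Rightarrow> 'a mat" where
  "row_block_mat nr Ms = foldr (@\<^sub>c) Ms (0\<^sub>m nr 0)"

definition const_mat :: "complex mat \<Rightarrow> complex poly mat" where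
  "const_mat A = map_mat (\<lambda>c. [:c:]) A"

definition eval_mat :: "complex poly mat \<Rightarrow> complex \<Rightarrow> complex mat" where
  "eval_mat P x = map_mat (\<lambda>p. poly p x) P"

definition mat_rank :: "complex mat \<Rightarrow> nat" where
  "mat_rank A = vec_space.rank (dim_row A) A"

definition pencil :: "complex mat \<Rightarrow> complex mat \<Rightarrow> complex poly mat" where
  "pencil A B = const_mat A - [:0, 1:] \<cdot>\<^sub>m const_mat B"

definition regular_pencil :: "complex poly mat \<Rightarrow> bool" where
  "regular_pencil P \<longleftrightarrow> square_mat P \<and> (\<forall>p \<in> elements_mat P. degree p \<le> 1) \<and> det P \<noteq> 0"

definition finite_eigenvalues :: "complex poly mat \<Rightarrow> complex set" where
  "finite_eigenvalues P = {x. poly (det P) x = 0}"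

text \<open>
  \<open>L\<close> is partitioned as \<open>[[D, -C], [B, A]]\<close> with the state matrix \<open>A\<close> in the bottom right
  corner. The predicate includes that the block found there is the given state matrix \<open>S\<close>.
\<close>

definition minimal_in_complex :: "complex poly mat \<Rightarrow> complex poly mat \<Rightarrow> bool" where
  "minimal_in_complex L S \<longleftrightarrow>
     (let N = dim_row S;
          (D, negC, B, A) = split_block L (dim_row L - N) (dim_col L - N);
          C = - negC
      in square_mat S \<and> A = S \<and>
         (\<forall>x. mat_rank (eval_mat A x @\<^sub>r eval_mat C x) = N \<and>
              mat_rank (eval_mat A x @\<^sub>c eval_mat B x) = N))"

text \<open>
  Rational functions are elements of the fraction field of the polynomials, so that
  \<open>partial_fractions l z h\<close> is \<open>\<Sum>\<^sub>j h\<^sub>j / (\<lambda> - z\<^sub>j)\<close> with no value convention at the nodes.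
\<close>

definition partial_fractions :: "nat \<Rightarrow> (nat \<Rightarrow> complex) \<Rightarrow> (nat \<Rightarrow> complex) \<Rightarrow> complex poly fract" where
  "partial_fractions l z h = (\<Sum>j = 1..l. to_fract [:h j:] / to_fract [:- z j, 1:])"

definition node_poly :: "nat \<Rightarrow> (nat \<Rightarrow> complex) \<Rightarrow> complex poly" where
  "node_poly l z = (\<Prod>j = 1..l. [:- z j, 1:])"

definition EF_pencil :: "nat \<Rightarrow> (nat \<Rightarrow> complex) \<Rightarrow> (nat \<Rightarrow> complex) \<Rightarrow> complex poly mat" where
  "EF_pencil l z w = mat l l (\<lambda>(i, j).
     if i = 0 then [:w (Suc j):]
     else if i = Suc j then [:- z (Suc j), 1:]
     else if i = j then [:z (Suc j), - 1:]
     else 0)"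

definition a_vec :: "nat \<Rightarrow> (nat \<Rightarrow> complex) \<Rightarrow> (nat \<Rightarrow> complex) \<Rightarrow> (complex \<Rightarrow> complex) \<Rightarrow> complex vec" where
  "a_vec l z w g = vec l (\<lambda>j. g (z (Suc j)) * w (Suc j))"

definition b_vec :: "nat \<Rightarrow> complex vec" where
  "b_vec l = unit_vec l 0"

definition b_stack :: "nat \<Rightarrow> (nat \<Rightarrow> nat) \<Rightarrow> complex vec" where
  "b_stack s l = foldr (@\<^sub>v) (map (\<lambda>i. b_vec (l i)) [1..<Suc s]) (0\<^sub>v 0)"

definition EF_diag ::
    "nat \<Rightarrow> (nat \<Rightarrow> nat) \<Rightarrow> (nat \<Rightarrow> nat \<Rightarrow> complex) \<Rightarrow> (nat \<Rightarrow> nat \<Rightarrow> complex) \<Rightarrow> complex poly mat" where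
  "EF_diag s l z w = diag_block_mat (map (\<lambda>i. EF_pencil (l i) (z i) (w i)) [1..<Suc s])"

definition state_matrix ::
    "nat \<Rightarrow> nat \<Rightarrow> (nat \<Rightarrow> nat) \<Rightarrow> (nat \<Rightarrow> nat \<Rightarrow> complex) \<Rightarrow> (nat \<Rightarrow> nat \<Rightarrow> complex) \<Rightarrow> complex poly mat" where
  "state_matrix n s l z w = EF_diag s l z w \<otimes>\<^sub>m 1\<^sub>m n"

definition L_R ::
    "nat \<Rightarrow> nat \<Rightarrow> nat \<Rightarrow> (nat \<Rightarrow> complex mat) \<Rightarrow> (nat \<Rightarrow> complex mat) \<Rightarrow>
     (nat \<Rightarrow> complex mat) \<Rightarrow> (nat \<Rightarrow> complex mat) \<Rightarrow> complex mat \<Rightarrow> complex mat \<Rightarrow>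
     (nat \<Rightarrow> nat) \<Rightarrow> (nat \<Rightarrow> nat \<Rightarrow> complex) \<Rightarrow> (nat \<Rightarrow> nat \<Rightarrow> complex) \<Rightarrow>
     (nat \<Rightarrow> complex \<Rightarrow> complex) \<Rightarrow> complex poly mat" where
  "L_R n k s A B C D X Y l z w g =
     (let N = n * (\<Sum>i = 1..s. l i);
          b = mat_of_cols (\<Sum>i = 1..s. l i) [b_stack s l];
          aT = (\<lambda>i. mat_of_rows (l i) [a_vec (l i) (z i) (w i) (g i)])
      in four_block_mat
           (row_block_mat n (map (\<lambda>i. pencil (A i) (B i)) [0..<k])
              @\<^sub>r (pencil X Y \<otimes>\<^sub>m 1\<^sub>m n))
           (row_block_mat n (map (\<lambda>i. const_mat (aT i) \<otimes>\<^sub>m pencil (C i) (D i)) [1..<Suc s])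
              @\<^sub>r 0\<^sub>m ((k - 1) * n) N)
           ((const_mat (- b) \<otimes>\<^sub>m 1\<^sub>m n) @\<^sub>c 0\<^sub>m N ((k - 1) * n))
           (state_matrix n s l z w))"

end

theory Submission
  imports Defs
begin

text \<open>
  Full column rank and full row rank are equivalent to trivial right and left kernels, so at every \<open>x\<close> two
  homogeneous linear systems have to be shown to admit only the zero solution. Both decouple. The state matrix
  \<open>(E - \<lambda>F) \<otimes> I\<close> is block diagonal, and by the disjointness of the spectra of the blocks \<open>E\<^sub>i - \<lambda>F\<^sub>i\<close> at most one
  of them is singular at \<open>x\<close>; a kernel vector vanishes on all other blocks. In the remaining block the system
  splits further along the \<open>n\<close> coordinates of the Kronecker factor, and two statements about a single
  barycentric pencil are left.
  
  For the right kernel, the output equations \<open>(a\<^sub>i\<^sup>T \<otimes> (C\<^sub>i - xD\<^sub>i)) v = 0\<close> can be stripped of the factor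
  \<open>C\<^sub>i - xD\<^sub>i\<close>, which is invertible since \<open>x\<close> is an eigenvalue of \<open>E\<^sub>i - \<lambda>F\<^sub>i\<close>. So each coordinate \<open>u\<close> of \<open>v\<close>
  satisfies \<open>a\<^sub>i\<^sup>T u = 0\<close> and \<open>(E\<^sub>i - xF\<^sub>i) u = 0\<close>. The bidiagonal rows of the pencil make \<open>(x - z\<^sub>j) u\<^sub>j\<close> a
  constant \<open>c\<close>; clearing denominators, \<open>a\<^sub>i\<^sup>T u = 0\<close> and the first row become \<open>c p\<^sub>i(x) = 0\<close> and \<open>c q\<^sub>i(x) = 0\<close>.
  Irreducibility gives \<open>c = 0\<close>, and then \<open>u = 0\<close> because the nodes are distinct and the weights nonzero
  (\<open>EF_pencil_right_kernel\<close>).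
  
  For the left kernel, the input columns \<open>-b \<otimes> I\<close> force the first entry of each coordinate in the singular
  block to be zero. The columns of the pencil then say that the products of \<open>x - z\<^sub>j\<close> with the consecutive
  differences of the entries vanish, while the differences add up to zero; as only one node can equal \<open>x\<close>, all
  of them are zero (\<open>EF_pencil_left_kernel\<close>).
  
  The rest of the text makes the decoupling precise: a calculus of block and Kronecker indices yields the
  entries of the system matrix, and \<open>minimal_in_complexI\<close> turns minimality into the two kernel statements.
\<close>

section \<open>Full rank and trivial kernels\<close>

lemma mult_mat_vec_index_sum:
  assumes "M \<in> carrier_mat m n" "v \<in> carrier_vec n" "i < m"
  shows "(M *\<^sub>v v) $ i = (\<Sum>j<n. M $$ (i, j) * v $ j)"
  using assms by (auto simp: scalar_prod_def lessThan_atLeast0 intro!: sum.cong)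

lemma mult_mat_vec_eq_0_iff:
  assumes "M \<in> carrier_mat m n" "v \<in> carrier_vec n"
  shows "M *\<^sub>v v = 0\<^sub>v m \<longleftrightarrow> (\<forall>i<m. (\<Sum>j<n. M $$ (i, j) * v $ j) = 0)"
proof
  assume "M *\<^sub>v v = 0\<^sub>v m"
  then show "\<forall>i<m. (\<Sum>j<n. M $$ (i, j) * v $ j) = 0"
    using mult_mat_vec_index_sum[OF assms] by (metis index_zero_vec(1))
next
  assume "\<forall>i<m. (\<Sum>j<n. M $$ (i, j) * v $ j) = 0"
  then show "M *\<^sub>v v = 0\<^sub>v m"
    using mult_mat_vec_index_sum[OF assms] assms by (intro eq_vecI) auto
qed

lemma mat_rank_eq_dim_col:
  assumes M: "M \<in> carrier_mat m n"
    and kernel: "\<And>v. v \<in> carrier_vec n \<Longrightarrow> M *\<^sub>v v = 0\<^sub>v m \<Longrightarrow> v = 0\<^sub>v n"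
  shows "mat_rank M = n"
proof -
  interpret vec_space "TYPE(complex)" m .
  have distinct: "distinct (cols M)"
  proof (rule ccontr)
    assume "\<not> distinct (cols M)"
    then obtain i j where ij: "i \<noteq> j" "i < n" "j < n" "col M i = col M j"
      using M by (auto simp: distinct_conv_nth)
    let ?v = "unit_vec n i - unit_vec n j :: complex vec"
    have "M *\<^sub>v ?v = M *\<^sub>v unit_vec n i - M *\<^sub>v unit_vec n j"
      using M by (intro mult_minus_distrib_mat_vec) auto
    also have "\<dots> = 0\<^sub>v m"
    proof (intro eq_vecI)
      fix r assume "r < dim_vec (0\<^sub>v m :: complex vec)"
      then have r: "r < m" by simp
      have "M $$ (r, i) = M $$ (r, j)" using arg_cong[OF ij(4), of "\<lambda>c. c $ r"] M ij(2,3) r by (simp add: col_def)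
      then show "(M *\<^sub>v unit_vec n i - M *\<^sub>v unit_vec n j) $ r = 0\<^sub>v m $ r"
        using M ij r by simp
    qed (use M in simp)
    finally have "?v = 0\<^sub>v n" by (intro kernel) auto
    then have "?v $ i = 0" using ij by simp
    then show False using ij by simp
  qed
  have "\<not> lin_dep (set (cols M))"
    using lin_depE[OF M _ distinct] kernel by metis
  then show ?thesis
    using lin_indpt_full_rank[OF M distinct] M by (simp add: mat_rank_def)
qed

text \<open>
  A trivial left kernel makes the Gram matrix \<open>M M\<^sup>*\<close> injective, because \<open>M M\<^sup>* y = 0\<close> forces
  \<open>M\<^sup>* y\<close> to have length zero. Being square, the Gram matrix is then invertible, so every vector lies in
  the column space of \<open>M\<close>.
\<close>

lemma mat_rank_eq_dim_row:
  assumes M: "M \<in> carrier_mat m n"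
    and kernel: "\<And>y. y \<in> carrier_vec m \<Longrightarrow> M\<^sup>T *\<^sub>v y = 0\<^sub>v n \<Longrightarrow> y = 0\<^sub>v m"
  shows "mat_rank M = m"
proof -
  interpret vec_space "TYPE(complex)" m .
  define H where "H = map_mat cnj (M\<^sup>T)"
  have H: "H \<in> carrier_mat n m" using M by (simp add: H_def)
  have conj_mult: "H *\<^sub>v y = conjugate (M\<^sup>T *\<^sub>v conjugate y)" if y: "y \<in> carrier_vec m" for y
  proof (intro eq_vecI)
    fix j assume "j < dim_vec (conjugate (M\<^sup>T *\<^sub>v conjugate y))"
    then have j: "j < n" using M by simp
    have "(H *\<^sub>v y) $ j = (\<Sum>i<m. cnj (M $$ (i, j)) * y $ i)"
      using mult_mat_vec_index_sum[OF H y j] M j by (simp add: H_def)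
    also have "\<dots> = cnj (\<Sum>i<m. M $$ (i, j) * cnj (y $ i))"
      by simp
    also have "(\<Sum>i<m. M $$ (i, j) * cnj (y $ i)) = (M\<^sup>T *\<^sub>v conjugate y) $ j"
      using mult_mat_vec_index_sum[of "M\<^sup>T" n m "conjugate y" j] M y j by simp
    finally show "(H *\<^sub>v y) $ j = conjugate (M\<^sup>T *\<^sub>v conjugate y) $ j"
      using M j by simp
  qed (use M H in simp)
  \<comment> \<open>\<open>H\<close> is the adjoint of \<open>M\<close>; if \<open>M H y = 0\<close> then \<open>u = conjugate (H y)\<close> satisfies \<open>u \<bullet>c u = 0\<close>.\<close>
  have "det (M * H) \<noteq> 0"
  proof
    assume "det (M * H) = 0"
    then obtain y where y: "y \<in> carrier_vec m" "y \<noteq> 0\<^sub>v m" "(M * H) *\<^sub>v y = 0\<^sub>v m"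
      using det_0_iff_vec_prod_zero_field[of "M * H" m] M H by auto
    define u where "u = M\<^sup>T *\<^sub>v conjugate y"
    have u: "u \<in> carrier_vec n"
      unfolding u_def using M by (intro mult_mat_vec_carrier[of _ n m]) (use y(1) in auto)
    have Hy: "H *\<^sub>v y = conjugate u" using conj_mult[OF y(1)] by (simp add: u_def)
    have "u \<bullet>c u = (M\<^sup>T *\<^sub>v conjugate y) \<bullet> (H *\<^sub>v y)" by (simp add: Hy u_def)
    also have "\<dots> = conjugate y \<bullet> (M *\<^sub>v (H *\<^sub>v y))"
      using transpose_vec_mult_scalar[OF M, of "H *\<^sub>v y" "conjugate y"] H y(1) by simp
    also have "M *\<^sub>v (H *\<^sub>v y) = 0\<^sub>v m"
      using assoc_mult_mat_vec[OF M H y(1)] y(3) by metis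
    also have "conjugate y \<bullet> 0\<^sub>v m = 0" using y(1) by simp
    finally have "u = 0\<^sub>v n" using u by simp
    then have "y = 0\<^sub>v m"
      using kernel[of "conjugate y"] y(1) by (simp add: u_def)
    then show False using y(2) by simp
  qed
  moreover have MH: "M * H \<in> carrier_mat m m" using M H by simp
  ultimately obtain R where R: "R \<in> carrier_mat m m" "(M * H) * R = 1\<^sub>m m"
    using det_non_zero_imp_unit[OF MH, of "()"] by (auto simp: Units_def ring_mat_def)
  have HR: "H * R \<in> carrier_mat n m" using H R(1) by simp
  have "span (set (cols M)) = carrier_vec m"
  proof
    show "span (set (cols M)) \<subseteq> carrier_vec m"
      using cols_dim[of M] M by (intro span_is_subset2) simp
    show "carrier_vec m \<subseteq> span (set (cols M))"
    proof
      fix y :: "complex vec" assume y: "y \<in> carrier_vec m"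
      have "M *\<^sub>v ((H * R) *\<^sub>v y) = (M * (H * R)) *\<^sub>v y"
        using assoc_mult_mat_vec[OF M HR y] by simp
      also have "M * (H * R) = 1\<^sub>m m"
        using assoc_mult_mat[OF M H R(1)] R(2) by simp
      finally have "M *\<^sub>v ((H * R) *\<^sub>v y) = y" using y by simp
      moreover have "(H * R) *\<^sub>v y \<in> carrier_vec n"
        using HR y by (rule mult_mat_vec_carrier)
      ultimately have "y \<in> col_space M"
        using M y unfolding col_space_eq[OF M] by blast
      then show "y \<in> span (set (cols M))" by (simp only: col_space_def)
    qed
  qed
  moreover have "vs (carrier_vec m) = V"
    by (simp add: module_vec_def)
  ultimately have "rank M = dim"
    by (simp only: rank_def)
  then show ?thesis
    using M by (simp add: mat_rank_def dim_is_n)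
qed

section \<open>Block indices\<close>

text \<open>
  The position at which the \<open>i\<close>-th of consecutive blocks of sizes \<open>ls\<close> begins. Every index into a block
  matrix is written as \<open>offset ls i + b\<close> with \<open>b < ls ! i\<close>, which turns a sum over all indices into a
  double sum over blocks and positions.
\<close>

definition offset :: "nat list \<Rightarrow> nat \<Rightarrow> nat" where
  "offset ls i = sum_list (take i ls)"

lemma offset_0 [simp]: "offset ls 0 = 0"
  and offset_Cons_Suc [simp]: "offset (k # ls) (Suc i) = k + offset ls i"
  by (simp_all add: offset_def)

lemma offset_map_mult: "offset (map (\<lambda>k. k * n) ls) i = offset ls i * n"
  by (simp add: offset_def take_map sum_list_mult_const)

lemma offset_less:
  "i < length ls \<Longrightarrow> b < ls ! i \<Longrightarrow> offset ls i + b < sum_list ls"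
proof (induction ls arbitrary: i)
  case (Cons k ls)
  then show ?case by (cases i) auto
qed simp

lemma ex_block_index:
  "t < sum_list ls \<Longrightarrow> \<exists>i<length ls. \<exists>b<ls ! i. t = offset ls i + b"
proof (induction ls arbitrary: t)
  case (Cons k ls)
  show ?case
  proof (cases "t < k")
    case True
    then show ?thesis by (intro exI[of _ 0]) auto
  next
    case False
    then have "t - k < sum_list ls" using Cons.prems by simp
    then obtain i b where "i < length ls" "b < ls ! i" "t - k = offset ls i + b"
      using Cons.IH by blast
    with False show ?thesis by (intro exI[of _ "Suc i"] conjI exI[of _ b]) auto
  qed
qed simp

lemma sum_blocks:
  fixes f :: "nat \<Rightarrow> 'a :: comm_monoid_add"
  shows "(\<Sum>t<sum_list ls. f t) = (\<Sum>i<length ls. \<Sum>b<ls ! i. f (offset ls i + b))"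
proof (induction ls arbitrary: f)
  case (Cons k ls)
  have "(\<Sum>t<k + sum_list ls. f t) = (\<Sum>t<k. f t) + (\<Sum>t<sum_list ls. f (k + t))"
    using sum.atLeastLessThan_concat[of 0 k "k + sum_list ls" f]
      sum.shift_bounds_nat_ivl[of f 0 k "sum_list ls"]
    by (simp add: lessThan_atLeast0 add.commute)
  then show ?case
    by (simp add: Cons.IH sum.lessThan_Suc_shift add.assoc del: sum.lessThan_Suc)
qed simp

lemma diag_block_mat_index:
  assumes "i < length As" "a < dim_row (As ! i)" "j < length As" "b < dim_col (As ! j)"
  shows "diag_block_mat As $$ (offset (map dim_row As) i + a, offset (map dim_col As) j + b)
    = (if i = j then As ! i $$ (a, b) else 0)"
  using assms
proof (induction As arbitrary: i j)
  case (Cons A As)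
  have "offset (map dim_row As) i' + a < dim_row (diag_block_mat As)"
    if "i' < length As" "a < dim_row (As ! i')" for i'
    using that offset_less[of i' "map dim_row As" a] by (simp add: dim_diag_block_mat)
  moreover have "offset (map dim_col As) j' + b < dim_col (diag_block_mat As)"
    if "j' < length As" "b < dim_col (As ! j')" for j'
    using that offset_less[of j' "map dim_col As" b] by (simp add: dim_diag_block_mat)
  ultimately show ?case
    using Cons by (cases i; cases j) (auto simp: Let_def)
qed simp

lemma append_cols_carrier:
  assumes "M \<in> carrier_mat nr a" "R \<in> carrier_mat nr b"
  shows "M @\<^sub>c R \<in> carrier_mat nr (a + b)"
  using assms by (auto simp: append_cols_def)

lemma append_cols_index:
  assumes "M \<in> carrier_mat nr a" "R \<in> carrier_mat nr b" "i < nr" "j < a + b"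
  shows "(M @\<^sub>c R) $$ (i, j) = (if j < a then M $$ (i, j) else R $$ (i, j - a))"
  using assms by (auto simp: append_cols_def)

lemma row_block_mat_carrier:
  assumes "\<And>M. M \<in> set Ms \<Longrightarrow> dim_row M = nr"
  shows "row_block_mat nr Ms \<in> carrier_mat nr (sum_list (map dim_col Ms))"
  using assms
proof (induction Ms)
  case (Cons M Ms)
  have "M \<in> carrier_mat nr (dim_col M)" using Cons.prems by auto
  moreover have "row_block_mat nr Ms \<in> carrier_mat nr (sum_list (map dim_col Ms))"
    using Cons.prems by (intro Cons.IH) auto
  ultimately have "M @\<^sub>c row_block_mat nr Ms \<in> carrier_mat nr (dim_col M + sum_list (map dim_col Ms))"
    by (rule append_cols_carrier)
  then show ?case by (simp add: row_block_mat_def)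
qed (simp add: row_block_mat_def)

lemma row_block_mat_index:
  assumes "\<And>M. M \<in> set Ms \<Longrightarrow> dim_row M = nr" "r < nr" "j < length Ms" "b < dim_col (Ms ! j)"
  shows "row_block_mat nr Ms $$ (r, offset (map dim_col Ms) j + b) = Ms ! j $$ (r, b)"
  using assms
proof (induction Ms arbitrary: j)
  case (Cons M Ms)
  have M: "M \<in> carrier_mat nr (dim_col M)" using Cons.prems by auto
  have R: "row_block_mat nr Ms \<in> carrier_mat nr (sum_list (map dim_col Ms))"
    using Cons.prems by (intro row_block_mat_carrier) auto
  have eq: "row_block_mat nr (M # Ms) = M @\<^sub>c row_block_mat nr Ms"
    by (simp add: row_block_mat_def)
  have "offset (map dim_col (M # Ms)) j + b < dim_col M + sum_list (map dim_col Ms)"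
    using offset_less[of j "map dim_col (M # Ms)" b] Cons.prems by (simp del: list.map add: nth_map) simp
  from append_cols_index[OF M R \<open>r < nr\<close> this] show ?case
    using Cons unfolding eq by (cases j) auto
qed simp

lemma foldr_append_vec_index:
  assumes "j < length vs" "b < dim_vec (vs ! j)"
  shows "foldr (@\<^sub>v) vs (0\<^sub>v 0) $ (offset (map dim_vec vs) j + b) = vs ! j $ b"
  using assms
proof (induction vs arbitrary: j)
  case (Cons v vs)
  have dim: "dim_vec (foldr (@\<^sub>v) vs (0\<^sub>v 0)) = sum_list (map dim_vec vs)" for vs :: "'a vec list"
    by (induction vs) auto
  have "offset (map dim_vec (v # vs)) j + b < dim_vec v + sum_list (map dim_vec vs)"
    using offset_less[of j "map dim_vec (v # vs)" b] Cons.prems by (simp del: list.map add: nth_map) simp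
  then show ?case using Cons by (cases j) (auto simp: dim[simplified])
qed simp

lemma kron_carrier:
  "A \<in> carrier_mat m n \<Longrightarrow> B \<in> carrier_mat p q \<Longrightarrow> A \<otimes>\<^sub>m B \<in> carrier_mat (m * p) (n * q)"
  by (auto simp: kron_def)

lemma kron_index_less:
  fixes a c :: nat
  assumes "a < m" "c < p"
  shows "a * p + c < m * p"
proof -
  have "a * p + c < Suc a * p" using assms by simp
  also have "\<dots> \<le> m * p" using assms by (intro mult_le_mono1) simp
  finally show ?thesis .
qed

lemma kron_index:
  assumes "A \<in> carrier_mat m n" "B \<in> carrier_mat p q" "a < m" "c < p" "b < n" "d < q"
  shows "(A \<otimes>\<^sub>m B) $$ (a * p + c, b * q + d) = A $$ (a, b) * B $$ (c, d)"
  using assms kron_index_less[of a m c p] kron_index_less[of b n d q] by (simp add: kron_def)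

lemma sum_kron_index:
  fixes f :: "nat \<Rightarrow> 'a :: comm_monoid_add"
  shows "(\<Sum>t<m * n. f t) = (\<Sum>a<m. \<Sum>c<n. f (a * n + c))"
proof -
  have "sum f {a * n..<a * n + n} = (\<Sum>c<n. f (a * n + c))" for a
    using sum.shift_bounds_nat_ivl[of f 0 "a * n" n]
    by (simp add: lessThan_atLeast0 add.commute)
  moreover have "(\<Sum>t<m * n. f t) = (\<Sum>a<m. sum f {a * n..<a * n + n})"
    by (simp add: sum.nat_group)
  ultimately have "(\<Sum>t<m * n. f t) = (\<Sum>a<m. \<Sum>c<n. f (a * n + c))"
    by simp
  then show ?thesis .
qed

text \<open>
  The kernel criteria are repeated with functions on indices in place of vectors: the vectors that occur
  below are slices of a long vector along one Kronecker coordinate.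
\<close>

lemma mat_rank_eq_dim_colI:
  assumes M: "M \<in> carrier_mat m n"
    and kernel: "\<And>v. \<forall>i<m. (\<Sum>j<n. M $$ (i, j) * v j) = 0 \<Longrightarrow> \<forall>j<n. v j = 0"
  shows "mat_rank M = n"
proof (rule mat_rank_eq_dim_col[OF M])
  fix v assume v: "v \<in> carrier_vec n" "M *\<^sub>v v = 0\<^sub>v m"
  then have "\<forall>j<n. v $ j = 0"
    using mult_mat_vec_eq_0_iff[OF M v(1)] kernel[of "\<lambda>j. v $ j"] by blast
  then show "v = 0\<^sub>v n" using v(1) by (intro eq_vecI) auto
qed

lemma mat_rank_eq_dim_rowI:
  assumes M: "M \<in> carrier_mat m n"
    and kernel: "\<And>y. \<forall>j<n. (\<Sum>i<m. M $$ (i, j) * y i) = 0 \<Longrightarrow> \<forall>i<m. y i = 0"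
  shows "mat_rank M = m"
proof (rule mat_rank_eq_dim_row[OF M])
  fix y assume y: "y \<in> carrier_vec m" "M\<^sup>T *\<^sub>v y = 0\<^sub>v n"
  have "(\<Sum>i<m. M $$ (i, j) * y $ i) = 0" if "j < n" for j
  proof -
    have "(\<Sum>i<m. M\<^sup>T $$ (j, i) * y $ i) = 0"
      using mult_mat_vec_eq_0_iff[of "M\<^sup>T" n m y] M y that by simp
    then show ?thesis using M that by simp
  qed
  then have "\<forall>i<m. y $ i = 0" using kernel[of "\<lambda>i. y $ i"] by blast
  then show "y = 0\<^sub>v m" using y(1) by (intro eq_vecI) auto
qed

section \<open>Minimality and evaluation of polynomial matrices\<close>

lemma eval_mat_carrier: "P \<in> carrier_mat m n \<Longrightarrow> eval_mat P x \<in> carrier_mat m n"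
  by (simp add: eval_mat_def)

lemma split_block_four_block_mat:
  assumes "A \<in> carrier_mat m r" "B \<in> carrier_mat m q" "C \<in> carrier_mat p r" "D \<in> carrier_mat p q"
  shows "split_block (four_block_mat A B C D) m r = (A, B, C, D)"
  using assms by (auto simp: split_block_def Let_def intro!: eq_matI)

lemma minimal_in_complexI:
  assumes G: "G \<in> carrier_mat m r" and H: "H \<in> carrier_mat m N"
    and B: "B \<in> carrier_mat N r" and S: "S \<in> carrier_mat N N"
    and right: "\<And>x v. \<forall>i<N. (\<Sum>j<N. poly (S $$ (i, j)) x * v j) = 0 \<Longrightarrow>
      \<forall>i<m. (\<Sum>j<N. poly (H $$ (i, j)) x * v j) = 0 \<Longrightarrow> \<forall>j<N. v j = 0"
    and left: "\<And>x y. \<forall>j<N. (\<Sum>i<N. poly (S $$ (i, j)) x * y i) = 0 \<Longrightarrow>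
      \<forall>j<r. (\<Sum>i<N. poly (B $$ (i, j)) x * y i) = 0 \<Longrightarrow> \<forall>i<N. y i = 0"
  shows "minimal_in_complex (four_block_mat G H B S) S"
proof -
  have split: "split_block (four_block_mat G H B S) m r = (G, H, B, S)"
    using G H B S by (rule split_block_four_block_mat)
  have rank_rows: "mat_rank (eval_mat S x @\<^sub>r eval_mat (- H) x) = N" for x
  proof (rule mat_rank_eq_dim_colI)
    show "eval_mat S x @\<^sub>r eval_mat (- H) x \<in> carrier_mat (N + m) N"
      using S H by (intro carrier_append_rows eval_mat_carrier) auto
    fix v :: "nat \<Rightarrow> complex"
    assume v: "\<forall>i<N + m. (\<Sum>j<N. (eval_mat S x @\<^sub>r eval_mat (- H) x) $$ (i, j) * v j) = 0"
    have "(\<Sum>j<N. poly (S $$ (i, j)) x * v j) = 0" if "i < N" for i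
    proof -
      have "(\<Sum>j<N. (eval_mat S x @\<^sub>r eval_mat (- H) x) $$ (i, j) * v j) = 0"
        using v that by simp
      then show ?thesis using that S H by (simp add: append_rows_def eval_mat_def)
    qed
    moreover have "(\<Sum>j<N. poly (H $$ (i, j)) x * v j) = 0" if "i < m" for i
    proof -
      have "(\<Sum>j<N. (eval_mat S x @\<^sub>r eval_mat (- H) x) $$ (N + i, j) * v j) = 0"
        using v that by simp
      then show ?thesis using that S H by (simp add: append_rows_def eval_mat_def sum_negf)
    qed
    ultimately show "\<forall>j<N. v j = 0" using right by blast
  qed
  have rank_cols: "mat_rank (eval_mat S x @\<^sub>c eval_mat B x) = N" for x
  proof (rule mat_rank_eq_dim_rowI)
    show "eval_mat S x @\<^sub>c eval_mat B x \<in> carrier_mat N (N + r)"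
      using S B by (intro append_cols_carrier eval_mat_carrier)
    fix y :: "nat \<Rightarrow> complex"
    assume y: "\<forall>j<N + r. (\<Sum>i<N. (eval_mat S x @\<^sub>c eval_mat B x) $$ (i, j) * y i) = 0"
    have "(\<Sum>i<N. poly (S $$ (i, j)) x * y i) = 0" if "j < N" for j
    proof -
      have "(\<Sum>i<N. (eval_mat S x @\<^sub>c eval_mat B x) $$ (i, j) * y i) = 0"
        using y that by simp
      then show ?thesis using that S B by (simp add: append_cols_def eval_mat_def)
    qed
    moreover have "(\<Sum>i<N. poly (B $$ (i, j)) x * y i) = 0" if "j < r" for j
    proof -
      have "(\<Sum>i<N. (eval_mat S x @\<^sub>c eval_mat B x) $$ (i, N + j) * y i) = 0"
        using y that by simp
      then show ?thesis using that S B by (simp add: append_cols_def eval_mat_def)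
    qed
    ultimately show "\<forall>i<N. y i = 0" using left by blast
  qed
  have "dim_row (four_block_mat G H B S) - dim_row S = m"
    "dim_col (four_block_mat G H B S) - dim_row S = r"
    using G S by simp_all
  then show ?thesis
    using split rank_rows rank_cols S by (simp add: minimal_in_complex_def Let_def)
qed

text \<open>
  Away from the finite eigenvalues of a polynomial matrix its evaluation is invertible; the following two
  lemmas make a block of a kernel vector vanish whenever the corresponding block of the state matrix is
  nonsingular.
\<close>

lemma det_nonzero_kernel:
  fixes P :: "complex poly mat"
  assumes P: "P \<in> carrier_mat n n" and det: "poly (det P) x \<noteq> 0"
    and u: "\<forall>i<n. (\<Sum>j<n. poly (P $$ (i, j)) x * u j) = 0"
  shows "\<forall>j<n. u j = 0"
proof -
  have E: "eval_mat P x \<in> carrier_mat n n" using P by (rule eval_mat_carrier)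
  interpret ev: comm_ring_hom "\<lambda>p :: complex poly. poly p x" by unfold_locales auto
  have "det (eval_mat P x) = poly (det P) x"
    unfolding eval_mat_def by (rule ev.hom_det)
  with det have "det (eval_mat P x) \<noteq> 0" by simp
  then have inj: "v = 0\<^sub>v n" if "v \<in> carrier_vec n" "eval_mat P x *\<^sub>v v = 0\<^sub>v n" for v
    using det_0_iff_vec_prod_zero_field[OF E] that by blast
  have "eval_mat P x *\<^sub>v vec n u = 0\<^sub>v n"
    using u P mult_mat_vec_eq_0_iff[OF E, of "vec n u"] by (simp add: eval_mat_def)
  then have "vec n u = 0\<^sub>v n" using inj[of "vec n u"] by simp
  then show ?thesis by (metis index_vec index_zero_vec(1))
qed

lemma det_nonzero_left_kernel:
  fixes P :: "complex poly mat"
  assumes P: "P \<in> carrier_mat n n" and det: "poly (det P) x \<noteq> 0"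
    and u: "\<forall>j<n. (\<Sum>i<n. poly (P $$ (i, j)) x * u i) = 0"
  shows "\<forall>i<n. u i = 0"
proof (rule det_nonzero_kernel[of "P\<^sup>T"])
  show "poly (det P\<^sup>T) x \<noteq> 0" using det det_transpose[OF P] by simp
qed (use P u in auto)

section \<open>Barycentric pencils\<close>

text \<open>
  Multiplication by the node polynomial clears the denominators of a partial fraction. It is carried out in
  the fraction field, so that the resulting polynomial can be evaluated at the nodes as well.
\<close>

lemma node_poly_mult_partial_fractions:
  "to_fract (node_poly l z) * partial_fractions l z h
    = to_fract (\<Sum>j = 1..l. [:h j:] * (\<Prod>i \<in> {1..l} - {j}. [:- z i, 1:]))"
proof -
  have *: "to_fract (node_poly l z) * (to_fract [:h j:] / to_fract [:- z j, 1:])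
      = to_fract ([:h j:] * (\<Prod>i \<in> {1..l} - {j}. [:- z i, 1:]))" if j: "j \<in> {1..l}" for j
  proof -
    have "node_poly l z = [:- z j, 1:] * (\<Prod>i \<in> {1..l} - {j}. [:- z i, 1:])"
      unfolding node_poly_def using j by (intro prod.remove) auto
    moreover have "to_fract [:- z j, 1:] \<noteq> 0" by simp
    ultimately show ?thesis by (simp only: to_fract_mult) (simp add: field_simps)
  qed
  have sum: "to_fract (sum f A) = (\<Sum>a\<in>A. to_fract (f a))" for f :: "nat \<Rightarrow> complex poly" and A
    by (induction A rule: infinite_finite_induct) auto
  show ?thesis
    unfolding partial_fractions_def sum_distrib_left sum
    by (intro sum.cong refl) (use * in simp)
qed

lemma poly_barycentric:
  assumes "to_fract p = to_fract (node_poly l z) * partial_fractions l z h"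
  shows "poly p x = (\<Sum>j = 1..l. h j * (\<Prod>i \<in> {1..l} - {j}. x - z i))"
proof -
  have "p = (\<Sum>j = 1..l. [:h j:] * (\<Prod>i \<in> {1..l} - {j}. [:- z i, 1:]))"
    using assms node_poly_mult_partial_fractions[of l z h] by (simp only: to_fract_eq_iff)
  then show ?thesis by (simp add: poly_sum poly_prod algebra_simps)
qed

text \<open>
  If \<open>(x - z j) * u j\<close> has the same value \<open>c\<close> for all \<open>j\<close>, then \<open>u\<close> is formally \<open>c / (x - z j)\<close>, and a
  linear functional \<open>h\<close> of \<open>u\<close> is \<open>c\<close> times the partial fraction with numerators \<open>h\<close>. In the form below the
  identity needs no division and therefore holds at the nodes too.
\<close>

lemma poly_barycentric_mult:
  assumes "to_fract p = to_fract (node_poly l z) * partial_fractions l z h"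
    and "\<And>j. j \<in> {1..l} \<Longrightarrow> (x - z j) * u j = c"
  shows "poly p x * c = (\<Prod>i \<in> {1..l}. x - z i) * (\<Sum>j = 1..l. h j * u j)"
proof -
  have "h j * (\<Prod>i \<in> {1..l} - {j}. x - z i) * c = (\<Prod>i \<in> {1..l}. x - z i) * (h j * u j)"
    if j: "j \<in> {1..l}" for j
  proof -
    have "(\<Prod>i \<in> {1..l}. x - z i) = (x - z j) * (\<Prod>i \<in> {1..l} - {j}. x - z i)"
      using j by (intro prod.remove) auto
    then show ?thesis by (simp add: assms(2)[OF j, symmetric])
  qed
  then show ?thesis
    unfolding poly_barycentric[OF assms(1)] sum_distrib_right sum_distrib_left
    by (intro sum.cong refl)
qed

lemma EF_pencil_carrier: "EF_pencil l z w \<in> carrier_mat l l"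
  by (simp add: EF_pencil_def)

text \<open>
  The rows of the pencil below the first say that \<open>(x - z (j + 1)) * u j\<close> does not depend on \<open>j\<close>; let \<open>c\<close> be
  the common value. The first row makes the weights annihilate \<open>u\<close> and the last hypothesis does the same
  for the numerators \<open>h\<close>, so \<open>c\<close> times either of the polynomials \<open>p\<close> and \<open>q\<close> vanishes at \<open>x\<close>. As they have
  no common zero, \<open>c = 0\<close>. Then only the entry of \<open>u\<close> at a node equal to \<open>x\<close> can survive, and the first row
  with its nonzero weight removes that one.
\<close>

lemma EF_pencil_right_kernel:
  assumes inj: "inj_on z {1..l}" and w: "\<And>j. j \<in> {1..l} \<Longrightarrow> w j \<noteq> 0"
    and p: "to_fract p = to_fract (node_poly l z) * partial_fractions l z h"
    and q: "to_fract q = to_fract (node_poly l z) * partial_fractions l z w"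
    and no_common_zero: "poly p x \<noteq> 0 \<or> poly q x \<noteq> 0"
    and kernel: "\<forall>i<l. (\<Sum>j<l. poly (EF_pencil l z w $$ (i, j)) x * u j) = 0"
    and h: "(\<Sum>j<l. h (Suc j) * u j) = 0"
  shows "\<forall>j<l. u j = 0"
proof (cases "l = 0")
  case False
  \<comment> \<open>\<open>v\<close> is \<open>u\<close> with the 1-based numbering of the nodes.\<close>
  define v where "v j = u (j - 1)" for j
  have shift: "(\<Sum>j<l. f (Suc j) * u j) = (\<Sum>j = 1..l. f j * v j)" for f :: "nat \<Rightarrow> complex"
    by (simp add: v_def sum.atLeast1_atMost_eq)
  have row0: "(\<Sum>j<l. w (Suc j) * u j) = 0"
    using kernel[rule_format, of 0] False by (simp add: EF_pencil_def)
  have row: "(x - z (Suc j)) * u j = (x - z (Suc (Suc j))) * u (Suc j)" if j: "Suc j < l" for j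
  proof -
    have "(\<Sum>i<l. poly (EF_pencil l z w $$ (Suc j, i)) x * u i)
        = (\<Sum>i<l. (if i = j then (x - z (Suc j)) * u j else 0)
            + (if i = Suc j then (z (Suc (Suc j)) - x) * u (Suc j) else 0))"
      using j by (intro sum.cong) (auto simp: EF_pencil_def algebra_simps)
    also have "\<dots> = (x - z (Suc j)) * u j + (z (Suc (Suc j)) - x) * u (Suc j)"
      using j by (simp add: sum.distrib sum.delta)
    finally have "(x - z (Suc j)) * u j + (z (Suc (Suc j)) - x) * u (Suc j) = 0"
      using kernel j by simp
    then show ?thesis by (simp add: algebra_simps add_eq_0_iff)
  qed
  define c where "c = (x - z 1) * u 0"
  have const: "(x - z (Suc j)) * u j = c" if "j < l" for j
    using that by (induction j) (auto simp: c_def row)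
  then have const': "(x - z j) * v j = c" if "j \<in> {1..l}" for j
    using that by (cases j) (auto simp: v_def)
  have "poly p x * c = 0"
    using poly_barycentric_mult[OF p const'] h by (simp add: shift)
  moreover have "poly q x * c = 0"
    using poly_barycentric_mult[OF q const'] row0 by (simp add: shift)
  ultimately have "c = 0" using no_common_zero by auto
  show ?thesis
  proof (cases "\<exists>m<l. x = z (Suc m)")
    case True
    then obtain m where m: "m < l" "x = z (Suc m)" by auto
    have other: "u j = 0" if "j < l" "j \<noteq> m" for j
      using const[OF that(1)] \<open>c = 0\<close> m that inj_onD[OF inj, of "Suc j" "Suc m"] by auto
    have "(\<Sum>j<l. w (Suc j) * u j) = w (Suc m) * u m"
      using m other by (subst sum.remove[of _ m]) auto
    then have "u m = 0" using row0 w[of "Suc m"] m by simp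
    then show ?thesis using other by metis
  next
    case False
    then show ?thesis using const \<open>c = 0\<close> by auto
  qed
qed simp

text \<open>
  Once the first entry of a left kernel vector is zero, column \<open>j\<close> of the pencil reads
  \<open>(x - z (j + 1)) * (u (j + 1) - u j) = 0\<close>, with the convention \<open>u l = 0\<close> in the last column. At most one
  node equals \<open>x\<close>, so all but one of these differences vanish; their sum telescopes to \<open>u l - u 0 = 0\<close>, so the
  remaining one vanishes as well and \<open>u\<close> is constantly zero.
\<close>

lemma EF_pencil_left_kernel:
  assumes inj: "inj_on z {1..l}"
    and kernel: "\<forall>j<l. (\<Sum>i<l. poly (EF_pencil l z w $$ (i, j)) x * u i) = 0"
    and u0: "u 0 = 0"
  shows "\<forall>i<l. u i = 0"
proof -
  define t where "t i = (if i < l then u i else 0)" for i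
  have step: "(x - z (Suc j)) * (t (Suc j) - t j) = 0" if j: "j < l" for j
  proof -
    have "(\<Sum>i<l. poly (EF_pencil l z w $$ (i, j)) x * u i)
        = (\<Sum>i<l. (if i = j then (z (Suc j) - x) * u j else 0)
            + (if i = Suc j then (x - z (Suc j)) * u (Suc j) else 0))"
      using j u0 by (intro sum.cong) (auto simp: EF_pencil_def algebra_simps)
    also have "\<dots> = (z (Suc j) - x) * t j + (x - z (Suc j)) * t (Suc j)"
      using j by (simp add: sum.distrib sum.delta t_def)
    finally show ?thesis using kernel j by (simp add: algebra_simps)
  qed
  have tl: "t l = 0" by (simp add: t_def)
  have t0: "t 0 = 0" by (simp add: t_def u0)
  have diff: "t (Suc j) = t j" if j: "j < l" for j
  proof (cases "x = z (Suc j)")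
    case True
    have "(\<Sum>i<l. t (Suc i) - t i) = t (Suc j) - t j"
    proof -
      have "t (Suc i) - t i = 0" if "i < l" "i \<noteq> j" for i
        using step[OF that(1)] True j that inj_onD[OF inj, of "Suc j" "Suc i"] by auto
      then show ?thesis using j by (subst sum.remove[of _ j]) auto
    qed
    moreover have "(\<Sum>i<l. t (Suc i) - t i) = t l - t 0" by (rule sum_lessThan_telescope)
    ultimately show ?thesis using t0 tl by simp
  next
    case False
    then show ?thesis using step[OF j] by simp
  qed
  have "t i = 0" if "i \<le> l" for i
    using that by (induction i) (auto simp: t0 diff)
  then have "u i = 0" if "i < l" for i
    using that by (metis t_def less_imp_le)
  then show ?thesis by blast
qed

section \<open>Entries of the system matrix\<close>

definition block_sizes :: "nat \<Rightarrow> (nat \<Rightarrow> nat) \<Rightarrow> nat list" where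
  "block_sizes s l = map l [1..<Suc s]"

text \<open>
  The row and column index, in the state matrix, of block \<open>i\<close>, position \<open>b\<close> in the block and coordinate \<open>c\<close>
  of the Kronecker factor of size \<open>n\<close>. Blocks are counted from \<open>0\<close> here, so block \<open>i\<close> carries the data with
  index \<open>Suc i\<close>.
\<close>

definition state_index :: "nat \<Rightarrow> nat \<Rightarrow> (nat \<Rightarrow> nat) \<Rightarrow> nat \<Rightarrow> nat \<Rightarrow> nat \<Rightarrow> nat" where
  "state_index n s l i b c = (offset (block_sizes s l) i + b) * n + c"

lemma length_block_sizes [simp]: "length (block_sizes s l) = s"
  by (simp add: block_sizes_def)

lemma nth_block_sizes [simp]: "i < s \<Longrightarrow> block_sizes s l ! i = l (Suc i)"
  by (simp add: block_sizes_def del: upt_Suc)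

lemma sum_list_block_sizes: "sum_list (block_sizes s l) = (\<Sum>i = 1..s. l i)"
  by (simp add: block_sizes_def interv_sum_list_conv_sum_set_nat atLeastLessThanSuc_atLeastAtMost
      del: upt_Suc)

lemma sum_state_index:
  fixes f :: "nat \<Rightarrow> 'a :: comm_monoid_add"
  shows "(\<Sum>t<n * (\<Sum>i = 1..s. l i). f t)
    = (\<Sum>i<s. \<Sum>b<l (Suc i). \<Sum>c<n. f (state_index n s l i b c))"
proof -
  have "(\<Sum>t<n * (\<Sum>i = 1..s. l i). f t) = (\<Sum>t<sum_list (block_sizes s l) * n. f t)"
    by (simp add: sum_list_block_sizes mult.commute)
  also have "\<dots> = (\<Sum>i<s. \<Sum>b<l (Suc i). \<Sum>c<n. f (state_index n s l i b c))"
    unfolding sum_kron_index sum_blocks by (simp add: state_index_def)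
  finally show ?thesis .
qed

lemma offset_block_less:
  assumes "i < s" "b < l (Suc i)"
  shows "offset (block_sizes s l) i + b < (\<Sum>i = 1..s. l i)"
  using offset_less[of i "block_sizes s l" b] assms by (simp add: sum_list_block_sizes)

lemma state_index_less:
  assumes "i < s" "b < l (Suc i)" "c < n"
  shows "state_index n s l i b c < n * (\<Sum>i = 1..s. l i)"
  using kron_index_less[OF offset_block_less[of i s b l, OF assms(1,2)] assms(3)]
  by (simp add: state_index_def mult.commute)

lemma ex_state_index:
  assumes t: "t < n * (\<Sum>i = 1..s. l i)"
  obtains i b c where "i < s" "b < l (Suc i)" "c < n" "t = state_index n s l i b c"
proof -
  have "0 < n" using t by (cases n) auto
  moreover have "t div n < sum_list (block_sizes s l)"
    using t by (simp add: sum_list_block_sizes less_mult_imp_div_less mult.commute)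
  then obtain i b where "i < s" "b < l (Suc i)" "t div n = offset (block_sizes s l) i + b"
    using ex_block_index[of "t div n" "block_sizes s l"] by auto
  moreover have "t = (t div n) * n + t mod n" by simp
  ultimately show thesis
    by (intro that[of i b "t mod n"]) (simp_all add: state_index_def)
qed

lemma EF_diag_carrier:
  "EF_diag s l z w \<in> carrier_mat (\<Sum>i = 1..s. l i) (\<Sum>i = 1..s. l i)"
proof -
  have "map (\<lambda>i. dim_row (EF_pencil (l i) (z i) (w i))) [1..<Suc s] = block_sizes s l"
    "map (\<lambda>i. dim_col (EF_pencil (l i) (z i) (w i))) [1..<Suc s] = block_sizes s l"
    by (simp_all add: EF_pencil_def block_sizes_def del: upt_Suc)
  then show ?thesis
    by (intro carrier_matI)
      (simp_all add: EF_diag_def dim_diag_block_mat comp_def sum_list_block_sizes del: upt_Suc)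
qed

lemma EF_diag_index:
  assumes "i < s" "a < l (Suc i)" "j < s" "b < l (Suc j)"
  shows "EF_diag s l z w $$ (offset (block_sizes s l) i + a, offset (block_sizes s l) j + b)
    = (if i = j then EF_pencil (l (Suc i)) (z (Suc i)) (w (Suc i)) $$ (a, b) else 0)"
proof -
  let ?As = "map (\<lambda>i. EF_pencil (l i) (z i) (w i)) [1..<Suc s]"
  have "map dim_row ?As = block_sizes s l" "map dim_col ?As = block_sizes s l"
    by (simp_all add: EF_pencil_def block_sizes_def comp_def del: upt_Suc)
  moreover have "?As ! i = EF_pencil (l (Suc i)) (z (Suc i)) (w (Suc i))" if "i < s" for i
    using that by (simp del: upt_Suc)
  moreover have "length ?As = s" by simp
  ultimately show ?thesis
    using diag_block_mat_index[of i ?As a j b] assms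
      EF_pencil_carrier[of "l (Suc i)" "z (Suc i)" "w (Suc i)"]
      EF_pencil_carrier[of "l (Suc j)" "z (Suc j)" "w (Suc j)"]
    by (simp add: EF_diag_def del: upt_Suc)
qed

lemma state_matrix_carrier:
  "state_matrix n s l z w \<in> carrier_mat (n * (\<Sum>i = 1..s. l i)) (n * (\<Sum>i = 1..s. l i))"
  using kron_carrier[OF EF_diag_carrier[of s l z w] one_carrier_mat[of n]]
  by (simp add: state_matrix_def mult.commute)

lemma state_matrix_index:
  assumes "i < s" "a < l (Suc i)" "c < n" "j < s" "b < l (Suc j)" "d < n"
  shows "state_matrix n s l z w $$ (state_index n s l i a c, state_index n s l j b d)
    = (if c = d then if i = j then EF_pencil (l (Suc i)) (z (Suc i)) (w (Suc i)) $$ (a, b) else 0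
       else 0)"
  using kron_index[OF EF_diag_carrier[of s l z w] one_carrier_mat[of n],
      of "offset (block_sizes s l) i + a" c "offset (block_sizes s l) j + b" d]
    assms offset_block_less[of i s a l] offset_block_less[of j s b l]
  by (simp add: state_matrix_def state_index_def EF_diag_index)

text \<open>
  Fixing the block \<open>i\<close> and the Kronecker coordinate \<open>c\<close> decouples the equations of the state matrix: each such
  slice of a kernel vector lies in the kernel of one barycentric pencil.
\<close>

lemma state_matrix_right_kernel:
  assumes kernel: "\<forall>t<n * (\<Sum>i = 1..s. l i).
      (\<Sum>t'<n * (\<Sum>i = 1..s. l i). poly (state_matrix n s l z w $$ (t, t')) x * v t') = 0"
    and "i < s" "c < n"
  shows "\<forall>a<l (Suc i). (\<Sum>b<l (Suc i).
    poly (EF_pencil (l (Suc i)) (z (Suc i)) (w (Suc i)) $$ (a, b)) x * v (state_index n s l i b c)) = 0"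
proof (intro allI impI)
  fix a assume a: "a < l (Suc i)"
  let ?E = "EF_pencil (l (Suc i)) (z (Suc i)) (w (Suc i))"
  let ?S = "state_matrix n s l z w"
  have "0 = (\<Sum>j<s. \<Sum>b<l (Suc j). \<Sum>d<n.
      poly (?S $$ (state_index n s l i a c, state_index n s l j b d)) x * v (state_index n s l j b d))"
    using kernel[rule_format, OF state_index_less[of i s a l c n, OF assms(2) a assms(3)]]
    unfolding sum_state_index by (rule sym)
  also have "\<dots> = (\<Sum>j<s. \<Sum>b<l (Suc j). \<Sum>d<n. if c = d then if i = j then
      poly (?E $$ (a, b)) x * v (state_index n s l j b d) else 0 else 0)"
    using assms a by (intro sum.cong refl) (simp add: state_matrix_index)
  also have "\<dots> = (\<Sum>j<s. if i = j then
      (\<Sum>b<l (Suc j). poly (?E $$ (a, b)) x * v (state_index n s l j b c)) else 0)"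
    using assms by (intro sum.cong refl) simp
  also have "\<dots> = (\<Sum>b<l (Suc i). poly (?E $$ (a, b)) x * v (state_index n s l i b c))"
    using assms by simp
  finally show "\<dots> = 0" by simp
qed

lemma state_matrix_left_kernel:
  assumes kernel: "\<forall>t'<n * (\<Sum>i = 1..s. l i).
      (\<Sum>t<n * (\<Sum>i = 1..s. l i). poly (state_matrix n s l z w $$ (t, t')) x * y t) = 0"
    and "i < s" "c < n"
  shows "\<forall>b<l (Suc i). (\<Sum>a<l (Suc i).
    poly (EF_pencil (l (Suc i)) (z (Suc i)) (w (Suc i)) $$ (a, b)) x * y (state_index n s l i a c)) = 0"
proof (intro allI impI)
  fix b assume b: "b < l (Suc i)"
  let ?E = "EF_pencil (l (Suc i)) (z (Suc i)) (w (Suc i))"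
  let ?S = "state_matrix n s l z w"
  have "0 = (\<Sum>j<s. \<Sum>a<l (Suc j). \<Sum>d<n.
      poly (?S $$ (state_index n s l j a d, state_index n s l i b c)) x * y (state_index n s l j a d))"
    using kernel[rule_format, OF state_index_less[of i s b l c n, OF assms(2) b assms(3)]]
    unfolding sum_state_index by (rule sym)
  also have "\<dots> = (\<Sum>j<s. \<Sum>a<l (Suc j). \<Sum>d<n. if c = d then if i = j then
      poly (?E $$ (a, b)) x * y (state_index n s l j a d) else 0 else 0)"
    using assms b by (intro sum.cong refl) (auto simp: state_matrix_index)
  also have "\<dots> = (\<Sum>j<s. if i = j then
      (\<Sum>a<l (Suc j). poly (?E $$ (a, b)) x * y (state_index n s l j a c)) else 0)"
    using assms by (intro sum.cong refl) simp
  also have "\<dots> = (\<Sum>a<l (Suc i). poly (?E $$ (a, b)) x * y (state_index n s l i a c))"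
    using assms by simp
  finally show "\<dots> = 0" by simp
qed

lemma pencil_carrier: "A \<in> carrier_mat m n \<Longrightarrow> B \<in> carrier_mat m n \<Longrightarrow> pencil A B \<in> carrier_mat m n"
  by (intro carrier_matI) (simp_all add: pencil_def const_mat_def)

lemma const_mat_carrier: "A \<in> carrier_mat m n \<Longrightarrow> const_mat A \<in> carrier_mat m n"
  by (simp add: const_mat_def)

lemma output_block_carrier:
  fixes CC DD :: "complex mat"
  assumes "CC \<in> carrier_mat n n" "DD \<in> carrier_mat n n"
  shows "const_mat (mat_of_rows k [a]) \<otimes>\<^sub>m pencil CC DD \<in> carrier_mat n (k * n)"
proof -
  have "const_mat (mat_of_rows k [a]) \<in> carrier_mat 1 k"
    using mat_of_rows_carrier(1)[of k "[a]"] by (intro const_mat_carrier) simp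
  from kron_carrier[OF this pencil_carrier[OF assms]] show ?thesis by simp
qed

lemma output_matrix:
  fixes n s :: nat and l :: "nat \<Rightarrow> nat"
    and C D :: "nat \<Rightarrow> complex mat" and a :: "nat \<Rightarrow> complex vec"
  assumes CD: "\<And>i. i \<in> {1..s} \<Longrightarrow> C i \<in> carrier_mat n n \<and> D i \<in> carrier_mat n n"
  defines "M \<equiv> row_block_mat n
      (map (\<lambda>i. const_mat (mat_of_rows (l i) [a i]) \<otimes>\<^sub>m pencil (C i) (D i)) [1..<Suc s])"
  shows output_matrix_carrier: "M \<in> carrier_mat n (n * (\<Sum>i = 1..s. l i))"
    and output_matrix_index: "\<And>r j b c. r < n \<Longrightarrow> j < s \<Longrightarrow> b < l (Suc j) \<Longrightarrow> c < n \<Longrightarrow>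
      M $$ (r, state_index n s l j b c)
        = [:a (Suc j) $ b:] * pencil (C (Suc j)) (D (Suc j)) $$ (r, c)"
proof -
  define Ms where "Ms = map (\<lambda>i. const_mat (mat_of_rows (l i) [a i]) \<otimes>\<^sub>m pencil (C i) (D i)) [1..<Suc s]"
  have M: "M = row_block_mat n Ms" by (simp only: M_def Ms_def)
  have nth: "Ms ! j = const_mat (mat_of_rows (l (Suc j)) [a (Suc j)]) \<otimes>\<^sub>m pencil (C (Suc j)) (D (Suc j))"
    if "j < s" for j
    using that by (simp add: Ms_def del: upt_Suc)
  have block: "const_mat (mat_of_rows (l i) [a i]) \<otimes>\<^sub>m pencil (C i) (D i) \<in> carrier_mat n (l i * n)"
    if "i \<in> {1..s}" for i
    using CD[OF that] by (intro output_block_carrier) auto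
  have rows: "\<And>B. B \<in> set Ms \<Longrightarrow> dim_row B = n"
    using carrier_matD(1)[OF block] by (auto simp: Ms_def simp del: upt_Suc)
  have cols: "map dim_col Ms = map (\<lambda>k. k * n) (block_sizes s l)"
    using carrier_matD(2)[OF block] by (auto simp: Ms_def block_sizes_def simp del: upt_Suc)
  show "M \<in> carrier_mat n (n * (\<Sum>i = 1..s. l i))"
    using row_block_mat_carrier[of Ms n, OF rows]
    by (simp add: M cols sum_list_mult_const sum_list_block_sizes mult.commute)
  fix r j b c assume *: "r < n" "j < s" "b < l (Suc j)" "c < n"
  have CDj: "C (Suc j) \<in> carrier_mat n n" "D (Suc j) \<in> carrier_mat n n"
    using CD[of "Suc j"] * by auto
  have len: "j < length Ms" using * by (simp add: Ms_def)
  have b: "b * n + c < dim_col (Ms ! j)"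
    using kron_index_less[OF *(3,4)] output_block_carrier[OF CDj, of "l (Suc j)" "a (Suc j)"] *
    by (simp add: nth)
  have "M $$ (r, state_index n s l j b c) = Ms ! j $$ (r, b * n + c)"
    using row_block_mat_index[of Ms n r j "b * n + c", OF rows *(1) len b]
    by (simp add: M cols offset_map_mult state_index_def algebra_simps)
  also have "\<dots> = [:a (Suc j) $ b:] * pencil (C (Suc j)) (D (Suc j)) $$ (r, c)"
    using kron_index[OF _ pencil_carrier[OF CDj], of "const_mat (mat_of_rows (l (Suc j)) [a (Suc j)])" 1
        "l (Suc j)" 0 r b c] *
    by (simp add: nth const_mat_def mat_of_rows_def)
  finally show "M $$ (r, state_index n s l j b c)
      = [:a (Suc j) $ b:] * pencil (C (Suc j)) (D (Suc j)) $$ (r, c)" .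
qed

lemma b_stack_index:
  assumes "i < s" "b < l (Suc i)"
  shows "b_stack s l $ (offset (block_sizes s l) i + b) = (if b = 0 then 1 else 0)"
proof -
  let ?vs = "map (\<lambda>i. b_vec (l i)) [1..<Suc s]"
  have "map dim_vec ?vs = block_sizes s l"
    by (simp add: b_vec_def block_sizes_def comp_def del: upt_Suc)
  moreover have "?vs ! i = b_vec (l (Suc i))" using assms by (simp del: upt_Suc)
  ultimately show ?thesis
    using foldr_append_vec_index[of i ?vs b] assms
    by (simp add: b_stack_def b_vec_def del: upt_Suc)
qed

lemma input_matrix:
  fixes n s :: nat and l :: "nat \<Rightarrow> nat"
  defines "m \<equiv> \<Sum>i = 1..s. l i"
  defines "M \<equiv> const_mat (- mat_of_cols m [b_stack s l]) \<otimes>\<^sub>m 1\<^sub>m n"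
  shows input_matrix_carrier: "M \<in> carrier_mat (n * m) n"
    and input_matrix_index: "\<And>i b c d. i < s \<Longrightarrow> b < l (Suc i) \<Longrightarrow> c < n \<Longrightarrow> d < n \<Longrightarrow>
      M $$ (state_index n s l i b c, d) = (if c = d then if b = 0 then - 1 else 0 else 0)"
proof -
  have b: "const_mat (- mat_of_cols m [b_stack s l]) \<in> carrier_mat m 1"
    using mat_of_cols_carrier(1)[of m "[b_stack s l]"] by (intro const_mat_carrier) simp
  show "M \<in> carrier_mat (n * m) n"
    using kron_carrier[OF b one_carrier_mat[of n]] by (simp add: M_def mult.commute)
  fix i b' c d assume *: "i < s" "b' < l (Suc i)" "c < n" "d < n"
  have less: "offset (block_sizes s l) i + b' < m"
    using offset_block_less[of i s b' l, OF *(1,2)] by (simp add: m_def)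
  show "M $$ (state_index n s l i b' c, d) = (if c = d then if b' = 0 then - 1 else 0 else 0)"
    using kron_index[OF b one_carrier_mat[of n] less *(3), of 0 d] * less
    by (simp add: M_def state_index_def const_mat_def mat_of_cols_def b_stack_index one_pCons)
qed

section \<open>Minimality\<close>

theorem theorem4p8:
  fixes n k s :: nat
    and A B C D :: "nat \<Rightarrow> complex mat"
    and X Y :: "complex mat"
    and f :: "nat \<Rightarrow> complex poly"
    and l :: "nat \<Rightarrow> nat"
    and g :: "nat \<Rightarrow> complex \<Rightarrow> complex"
    and z w :: "nat \<Rightarrow> nat \<Rightarrow> complex"
    and r :: "nat \<Rightarrow> complex poly fract"
    and p q :: "nat \<Rightarrow> complex poly"
  assumes n: "1 \<le> n" and k: "1 \<le> k"
    and AB: "\<And>i. i < k \<Longrightarrow> A i \<in> carrier_mat n n \<and> B i \<in> carrier_mat n n"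
    and CD: "\<And>i. i \<in> {1..s} \<Longrightarrow> C i \<in> carrier_mat n n \<and> D i \<in> carrier_mat n n"
    and XY: "X \<in> carrier_mat (k - 1) k" "Y \<in> carrier_mat (k - 1) k"
    and XY_rank: "\<And>x. mat_rank (eval_mat (pencil X Y) x) = k - 1"
    and f_0: "f 0 = 1"
    and XY_f: "pencil X Y *\<^sub>v vec k f = 0\<^sub>v (k - 1)"
    and l: "\<And>i. i \<in> {1..s} \<Longrightarrow> 1 \<le> l i"
    and z: "\<And>i. i \<in> {1..s} \<Longrightarrow> inj_on (z i) {1..l i}"
    and w: "\<And>i j. i \<in> {1..s} \<Longrightarrow> j \<in> {1..l i} \<Longrightarrow> w i j \<noteq> 0"
    and r: "\<And>i. i \<in> {1..s} \<Longrightarrow>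
      r i = partial_fractions (l i) (z i) (\<lambda>j. g i (z i j) * w i j)
              / partial_fractions (l i) (z i) (w i)"
    and p: "\<And>i. i \<in> {1..s} \<Longrightarrow>
      to_fract (p i) = to_fract (node_poly (l i) (z i))
              * partial_fractions (l i) (z i) (\<lambda>j. g i (z i j) * w i j)"
    and q: "\<And>i. i \<in> {1..s} \<Longrightarrow>
      to_fract (q i) = to_fract (node_poly (l i) (z i)) * partial_fractions (l i) (z i) (w i)"
    and r_pq: "\<And>i. i \<in> {1..s} \<Longrightarrow> r i = to_fract (p i) / to_fract (q i)"
    and irreducible: "\<And>i. i \<in> {1..s} \<Longrightarrow> \<not> (\<exists>x. poly (p i) x = 0 \<and> poly (q i) x = 0)"
    and CD_regular: "\<And>i. i \<in> {1..s} \<Longrightarrow> regular_pencil (pencil (C i) (D i))"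
    and EF_regular: "\<And>i. i \<in> {1..s} \<Longrightarrow> regular_pencil (EF_pencil (l i) (z i) (w i))"
    and a: "\<And>i. i \<in> {1..s} \<Longrightarrow>
      finite_eigenvalues (pencil (C i) (D i))
        \<inter> finite_eigenvalues (EF_pencil (l i) (z i) (w i)) = {}"
    and b: "\<And>i j. i \<in> {1..s} \<Longrightarrow> j \<in> {1..s} \<Longrightarrow> i \<noteq> j \<Longrightarrow>
      finite_eigenvalues (EF_pencil (l i) (z i) (w i))
        \<inter> finite_eigenvalues (EF_pencil (l j) (z j) (w j)) = {}"
  shows "minimal_in_complex (L_R n k s A B C D X Y l z w g) (state_matrix n s l z w)"
proof -
  define N where "N = n * (\<Sum>i = 1..s. l i)"
  define \<iota> where "\<iota> = state_index n s l"
  define G where "G = row_block_mat n (map (\<lambda>i. pencil (A i) (B i)) [0..<k])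
      @\<^sub>r (pencil X Y \<otimes>\<^sub>m 1\<^sub>m n)"
  define M where "M = row_block_mat n (map (\<lambda>i. const_mat (mat_of_rows (l i)
      [a_vec (l i) (z i) (w i) (g i)]) \<otimes>\<^sub>m pencil (C i) (D i)) [1..<Suc s])"
  define K where "K = const_mat (- mat_of_cols (\<Sum>i = 1..s. l i) [b_stack s l]) \<otimes>\<^sub>m 1\<^sub>m n"
  define S where "S = state_matrix n s l z w"
  have L: "L_R n k s A B C D X Y l z w g = four_block_mat G
      (M @\<^sub>r 0\<^sub>m ((k - 1) * n) N) (K @\<^sub>c 0\<^sub>m N ((k - 1) * n)) S"
    by (simp only: L_R_def Let_def G_def M_def K_def S_def N_def)
  have k_cols: "k * n = n + (k - 1) * n"
    using k by (cases k) auto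
  have dims: "\<And>i. i < k \<Longrightarrow> pencil (A i) (B i) \<in> carrier_mat n n"
    using AB by (intro pencil_carrier) auto
  have map_dims: "map dim_col (map (\<lambda>i. pencil (A i) (B i)) [0..<k]) = replicate k n"
    using carrier_matD(2)[OF dims] by (intro nth_equalityI) auto
  have "row_block_mat n (map (\<lambda>i. pencil (A i) (B i)) [0..<k])
      \<in> carrier_mat n (sum_list (map dim_col (map (\<lambda>i. pencil (A i) (B i)) [0..<k])))"
    by (rule row_block_mat_carrier) (use carrier_matD(1)[OF dims] in auto)
  then have "row_block_mat n (map (\<lambda>i. pencil (A i) (B i)) [0..<k]) \<in> carrier_mat n (k * n)"
    unfolding map_dims by (simp add: sum_list_replicate)
  moreover have "pencil X Y \<otimes>\<^sub>m 1\<^sub>m n \<in> carrier_mat ((k - 1) * n) (k * n)"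
    using XY by (intro kron_carrier pencil_carrier one_carrier_mat)
  ultimately have "G \<in> carrier_mat (n + (k - 1) * n) (k * n)"
    unfolding G_def by (rule carrier_append_rows)
  then have G: "G \<in> carrier_mat (n + (k - 1) * n) (n + (k - 1) * n)"
    by (simp only: k_cols)
  have M: "M \<in> carrier_mat n N"
    unfolding M_def N_def using CD by (rule output_matrix_carrier)
  have K: "K \<in> carrier_mat N n"
    unfolding K_def N_def by (rule input_matrix_carrier)
  have S: "S \<in> carrier_mat N N"
    unfolding S_def N_def by (rule state_matrix_carrier)
  have det_EF: "poly (det (EF_pencil (l (Suc j)) (z (Suc j)) (w (Suc j)))) x \<noteq> 0"
    if "i < s" "j < s" "i \<noteq> j" "poly (det (EF_pencil (l (Suc i)) (z (Suc i)) (w (Suc i)))) x = 0" for i j x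
    using b[of "Suc i" "Suc j"] that by (auto simp: finite_eigenvalues_def)
  \<comment> \<open>Observability: at most one block is singular at \<open>x\<close>. The other blocks of a kernel vector vanish, so the
    output equations involve the singular block alone.\<close>
  have right: "\<forall>t<N. v t = 0"
    if kerS: "\<forall>t<N. (\<Sum>t'<N. poly (S $$ (t, t')) x * v t') = 0"
      and kerM: "\<forall>t<n + (k - 1) * n.
        (\<Sum>t'<N. poly ((M @\<^sub>r 0\<^sub>m ((k - 1) * n) N) $$ (t, t')) x * v t') = 0" for x v
  proof -
    define E where "E i = EF_pencil (l (Suc i)) (z (Suc i)) (w (Suc i))" for i
    have ker_E: "\<forall>a<l (Suc i). (\<Sum>b<l (Suc i). poly (E i $$ (a, b)) x * v (\<iota> i b c)) = 0"
      if "i < s" "c < n" for i c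
      using state_matrix_right_kernel[OF kerS[unfolded S_def N_def] that]
      by (simp add: E_def \<iota>_def)
    have regular_block: "v (\<iota> i b c) = 0"
      if "i < s" "b < l (Suc i)" "c < n" "poly (det (E i)) x \<noteq> 0" for i b c
      using det_nonzero_kernel[OF _ that(4) ker_E[OF that(1,3)]] EF_pencil_carrier that(2)
      by (auto simp: E_def)
    have block: "v (\<iota> i b c) = 0" if i: "i < s" and b: "b < l (Suc i)" and c: "c < n" for i b c
    proof (cases "poly (det (E i)) x = 0")
      case False
      then show ?thesis using that by (intro regular_block)
    next
      case True
      have i': "Suc i \<in> {1..s}" using i by simp
      define P where "P = pencil (C (Suc i)) (D (Suc i))"
      define h where "h j = g (Suc i) (z (Suc i) j) * w (Suc i) j" for j
      have P: "P \<in> carrier_mat n n"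
        unfolding P_def using CD[OF i'] by (intro pencil_carrier) auto
      have others: "v (\<iota> j b c) = 0" if "j < s" "j \<noteq> i" "b < l (Suc j)" "c < n" for j b c
        using det_EF[of i j x] True that i by (intro regular_block) (auto simp: E_def)
      \<comment> \<open>The output row \<open>a\<^sub>i\<^sup>T \<otimes> P\<close> applied to the block is \<open>P\<close> applied to its \<open>a\<^sub>i\<close>-weighted combination,
        which is zero because \<open>P\<close> is nonsingular at the eigenvalue \<open>x\<close> of \<open>E i\<close>.\<close>
      have "(\<Sum>c<n. poly (P $$ (r, c)) x * (\<Sum>b<l (Suc i). h (Suc b) * v (\<iota> i b c))) = 0"
        if r: "r < n" for r
      proof -
        have "0 = (\<Sum>t<N. poly (M $$ (r, t)) x * v t)"
          using kerM[rule_format, of r] r M by (simp add: append_rows_def)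
        also have "\<dots> = (\<Sum>j<s. \<Sum>b<l (Suc j). \<Sum>c<n. poly (M $$ (r, \<iota> j b c)) x * v (\<iota> j b c))"
          unfolding N_def \<iota>_def by (rule sum_state_index)
        also have "\<dots> = (\<Sum>b<l (Suc i). \<Sum>c<n. poly (M $$ (r, \<iota> i b c)) x * v (\<iota> i b c))"
          using i others by (subst sum.remove[of _ i]) auto
        also have "\<dots> = (\<Sum>b<l (Suc i). \<Sum>c<n. poly (P $$ (r, c)) x * (h (Suc b) * v (\<iota> i b c)))"
          unfolding M_def \<iota>_def using i r
          by (intro sum.cong refl)
            (subst output_matrix_index[OF CD], auto simp: P_def a_vec_def h_def)
        also have "\<dots> = (\<Sum>c<n. \<Sum>b<l (Suc i). poly (P $$ (r, c)) x * (h (Suc b) * v (\<iota> i b c)))"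
          by (rule sum.swap)
        finally show ?thesis by (simp add: sum_distrib_left)
      qed
      moreover have "poly (det P) x \<noteq> 0"
        using a[OF i'] True by (auto simp: finite_eigenvalues_def P_def E_def)
      ultimately have "\<forall>c<n. (\<Sum>b<l (Suc i). h (Suc b) * v (\<iota> i b c)) = 0"
        using det_nonzero_kernel[OF P,
            of x "\<lambda>c. \<Sum>b<l (Suc i). h (Suc b) * v (\<iota> i b c)"] by blast
      then have combination: "(\<Sum>b<l (Suc i). h (Suc b) * v (\<iota> i b c)) = 0" using c by blast
      have p': "to_fract (p (Suc i))
          = to_fract (node_poly (l (Suc i)) (z (Suc i))) * partial_fractions (l (Suc i)) (z (Suc i)) h"
        using p[OF i'] by (simp add: h_def[abs_def])
      have no_common_zero: "poly (p (Suc i)) x \<noteq> 0 \<or> poly (q (Suc i)) x \<noteq> 0"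
        using irreducible[OF i'] by blast
      have "\<forall>b<l (Suc i). v (\<iota> i b c) = 0"
        using EF_pencil_right_kernel[where u = "\<lambda>b. v (\<iota> i b c)", OF z[OF i'] w[OF i'] p' q[OF i']
            no_common_zero ker_E[OF i c, unfolded E_def] combination] .
      then show ?thesis using b by blast
    qed
    show ?thesis
      unfolding N_def using block ex_state_index unfolding \<iota>_def by metis
  qed
  \<comment> \<open>Controllability: the input columns see only the sum of the first entries of all blocks. As the
    nonsingular blocks vanish, the first entry of the singular block is zero.\<close>
  have left: "\<forall>t<N. y t = 0"
    if kerS: "\<forall>t'<N. (\<Sum>t<N. poly (S $$ (t, t')) x * y t) = 0"
      and kerK: "\<forall>t'<n + (k - 1) * n.
        (\<Sum>t<N. poly ((K @\<^sub>c 0\<^sub>m N ((k - 1) * n)) $$ (t, t')) x * y t) = 0" for x y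
  proof -
    define E where "E i = EF_pencil (l (Suc i)) (z (Suc i)) (w (Suc i))" for i
    have ker_E: "\<forall>b<l (Suc i). (\<Sum>a<l (Suc i). poly (E i $$ (a, b)) x * y (\<iota> i a c)) = 0"
      if "i < s" "c < n" for i c
      using state_matrix_left_kernel[OF kerS[unfolded S_def N_def] that]
      by (simp add: E_def \<iota>_def)
    have regular_block: "y (\<iota> i b c) = 0"
      if "i < s" "b < l (Suc i)" "c < n" "poly (det (E i)) x \<noteq> 0" for i b c
      using det_nonzero_left_kernel[OF _ that(4) ker_E[OF that(1,3)]] EF_pencil_carrier that(2)
      by (auto simp: E_def)
    have firsts: "(\<Sum>i<s. y (\<iota> i 0 c)) = 0" if c: "c < n" for c
    proof -
      have "0 = (\<Sum>t<N. poly (K $$ (t, c)) x * y t)"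
        using kerK[rule_format, of c] c K by (simp add: append_cols_def)
      also have "\<dots> = (\<Sum>i<s. \<Sum>b<l (Suc i). \<Sum>d<n. poly (K $$ (\<iota> i b d, c)) x * y (\<iota> i b d))"
        unfolding N_def \<iota>_def by (rule sum_state_index)
      also have "\<dots> = (\<Sum>i<s. \<Sum>b<l (Suc i). \<Sum>d<n.
          if d = c then if b = 0 then - y (\<iota> i b d) else 0 else 0)"
        unfolding K_def \<iota>_def using c
        by (intro sum.cong refl) (subst input_matrix_index, auto)
      also have "\<dots> = (\<Sum>i<s. - y (\<iota> i 0 c))"
      proof (intro sum.cong refl)
        fix i assume "i \<in> {..<s}"
        then have "0 < l (Suc i)" using l[of "Suc i"] by simp
        then show "(\<Sum>b<l (Suc i). \<Sum>d<n. if d = c then if b = 0 then - y (\<iota> i b d) else 0 else 0)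
            = - y (\<iota> i 0 c)"
          using c by simp
      qed
      finally show ?thesis by (simp add: sum_negf)
    qed
    have block: "y (\<iota> i b c) = 0" if i: "i < s" and b: "b < l (Suc i)" and c: "c < n" for i b c
    proof (cases "poly (det (E i)) x = 0")
      case False
      then show ?thesis using that by (intro regular_block)
    next
      case True
      have i': "Suc i \<in> {1..s}" using i by simp
      have "y (\<iota> j 0 c) = 0" if "j < s" "j \<noteq> i" for j
        using det_EF[of i j x] True that i c l[of "Suc j"] by (intro regular_block) (auto simp: E_def)
      then have "y (\<iota> i 0 c) = 0"
        using firsts[OF c] i by (subst (asm) sum.remove[of _ i]) auto
      then have "\<forall>b<l (Suc i). y (\<iota> i b c) = 0"
        using EF_pencil_left_kernel[where u = "\<lambda>b. y (\<iota> i b c)",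
            OF z[OF i'] ker_E[OF i c, unfolded E_def]] by blast
      then show ?thesis using b by blast
    qed
    show ?thesis
      unfolding N_def using block ex_state_index unfolding \<iota>_def by metis
  qed
  have "minimal_in_complex (four_block_mat G
      (M @\<^sub>r 0\<^sub>m ((k - 1) * n) N) (K @\<^sub>c 0\<^sub>m N ((k - 1) * n)) S) S"
  proof (rule minimal_in_complexI)
    show "G \<in> carrier_mat (n + (k - 1) * n) (n + (k - 1) * n)" by (rule G)
    show "M @\<^sub>r 0\<^sub>m ((k - 1) * n) N \<in> carrier_mat (n + (k - 1) * n) N"
      using M zero_carrier_mat by (rule carrier_append_rows)
    show "K @\<^sub>c 0\<^sub>m N ((k - 1) * n) \<in> carrier_mat N (n + (k - 1) * n)"
      using K zero_carrier_mat by (rule append_cols_carrier)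
    show "S \<in> carrier_mat N N" by (rule S)
  qed (fact right, fact left)
  then show ?thesis unfolding L S_def[symmetric] .
qed

end
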